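(* Let $d\ge1$, $\alpha\in(0,2)$, and let $V:\mathbb{R}^d\to\mathbb{R}$ be a locally bounded Borel measurable function with $e^{-V}\in L^1(dx)$. Let $\phi\in C(\mathbb{R}^d)$ be such that $\phi>1$ and $\phi(x)=e^{|x|}$ for $|x|>1$. If $$\liminf_{|x|\to\infty}\frac{\inf_{|x|-1\le |z|\le |x|-1/2}e^{-V(z)}}{\sup_{|x|\le |z|\le |x|+1}e^{-V(z)}}>\frac{1}{\alpha}2^{2d+1}(e+e^{1/2})(2^\alpha-1),$$ then there are positive constants $C_1$, $b$ and $r_0$ such that for all $x\in\mathbb{R}^d$, $$\widetilde L_{\alpha,V}\phi(x)\le -C_1\Big(e^{V(x)}\inf_{|x|-1\le|z|\le|x|-1/2}e^{-V(z)}\Big)\phi(x)+b\,\mathbf{1}_{B(0,r_0)}(x).$$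
   Context: $C(\mathbb{R}^d)$ is the set of continuous functions on $\mathbb{R}^d$, and $B(0,r)$ is the ball of radius $r$ centered at $0$. For $f\in C(\mathbb{R}^d)$, $$\widetilde L_{\alpha,V}f(x):=\frac12\int_{\{1/2\le|x-y|\le1\}}\big(f(y)-f(x)\big)\frac{1+e^{V(x)-V(y)}}{|x-y|^{d+\alpha}}\,dy,\qquad x\in\mathbb{R}^d.$$ *)

theory Defs
  imports "HOL-Analysis.Analysis"
begin

definition locally_bounded :: "('a::topological_space \<Rightarrow> 'b::metric_space) \<Rightarrow> bool" where
  "locally_bounded f \<longleftrightarrow> (\<forall>x. \<exists>U. open U \<and> x \<in> U \<and> bounded (f ` U))"

text \<open>
  The integrand is bounded and Borel on the (bounded) domain of integration whenever \<open>f\<close> is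
  continuous and \<open>V\<close> is Borel and locally bounded, so the Bochner integral takes no default value there.
\<close>
definition L_trunc :: "real \<Rightarrow> (real ^ 'n \<Rightarrow> real) \<Rightarrow> (real ^ 'n \<Rightarrow> real) \<Rightarrow> real ^ 'n \<Rightarrow> real" where
  "L_trunc \<alpha> V f x =
     (1/2) * (LINT y : {y. 1/2 \<le> norm (x - y) \<and> norm (x - y) \<le> 1} | lborel.
        (f y - f x) * ((1 + exp (V x - V y)) / norm (x - y) powr (real CARD('n) + \<alpha>)))"

text \<open>
  For \<open>norm x < 1/2\<close> the set below is empty and \<open>inf_inner V x\<close> is the fixed real number
  \<open>Inf {}\<close> (the convention \<open>+\<infinity>\<close> would be meaningless in a real-valued upper bound). Which real
  number it is does not matter in a bound up to an additive constant on a ball around \<open>0\<close>,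
  as \<open>V\<close> is locally bounded. For \<open>norm x \<ge> 1/2\<close> it is a genuine infimum of a nonempty set
  bounded below by \<open>0\<close>.
\<close>
definition inf_inner :: "(real ^ 'n \<Rightarrow> real) \<Rightarrow> real ^ 'n \<Rightarrow> real" where
  "inf_inner V x = (INF z \<in> {z. norm x - 1 \<le> norm z \<and> norm z \<le> norm x - 1/2}. exp (- V z))"

definition sup_outer :: "(real ^ 'n \<Rightarrow> real) \<Rightarrow> real ^ 'n \<Rightarrow> real" where
  "sup_outer V x = (SUP z \<in> {z. norm x \<le> norm z \<and> norm z \<le> norm x + 1}. exp (- V z))"

end

theory Submission
  imports Defs
begin

text \<open>
  For large \<open>|x|\<close> put \<open>E = e\<^bsup>V(x)\<^esup> inf e\<^bsup>-V\<^esup>\<close>, the infimum over \<open>|x| - 1 \<le> |z| \<le> |x| - 1/2\<close>.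
  The hypothesis gives \<open>inf e\<^bsup>-V\<^esup> \<ge> K sup e\<^bsup>-V\<^esup>\<close>, and the set \<open>|x| \<le> |z| \<le> |x| + 1\<close> of the supremum
  contains \<open>x\<close>. Hence \<open>1 + e\<^bsup>V(x)-V(y)\<^esup> \<le> 2E/K\<close> whenever \<open>|x| \<le> |y| \<le> |x| + 1\<close>, and the positive part
  of the integral is at most \<open>\<phi>(x) (e - 1) 2E/K\<close> times the integral of the kernel over the annulus,
  which is at most \<open>d v (2\<^sup>\<alpha> - 1)/\<alpha>\<close> with \<open>v\<close> the volume of the unit ball. Where
  \<open>|y| \<le> |x| - 1/2\<close>, the integrand is at most \<open>-\<phi>(x) (1 - e\<^bsup>-1/2\<^esup>) E\<close>. The ball of radius 1/4
  inscribed in this region has volume \<open>v/4\<^sup>d\<close>, too small by a factor \<open>d\<close> for the stated constant. But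
  the region even contains the concentric spheroid with semi-axis 1/4 in the direction of \<open>x\<close> and
  semi-axes 1/2 orthogonally to it, of volume \<open>v/2\<^bsup>d+1\<^esup>\<close>, which suffices because
  \<open>d \<le> 2\<^bsup>d-1\<^esup>\<close>.
\<close>

section \<open>Rotation invariance of Lebesgue measure and the volume of a spheroid\<close>

text \<open>
  The library has this only for index types of class \<open>wellorder\<close>. Here \<open>f\<close> preserves the unit ball,
  which fixes the constant in the uniqueness argument for translation-invariant measures.
\<close>
lemma emeasure_lborel_vimage_orthogonal:
  fixes f :: "'a::euclidean_space \<Rightarrow> 'a"
  assumes f: "orthogonal_transformation f" and A: "A \<in> sets borel"
  shows "emeasure lborel (f -` A) = emeasure lborel A"
proof -
  let ?B = "ball 0 1 :: 'a set"
  have lin: "linear f" and nf: "\<And>v. norm (f v) = norm v"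
    using f by (auto simp: orthogonal_transformation)
  obtain g where g: "\<And>y. f (g y) = y"
    using orthogonal_transformation_surj[OF f] by (metis surj_f_inv_f)
  have fm [measurable]: "f \<in> borel_measurable borel"
    using lin by (simp add: borel_measurable_continuous_onI linear_continuous_on linear_conv_bounded_linear)
  have B [measurable]: "?B \<in> sets borel"
    by simp
  note A [measurable]
  have translate: "(\<integral>\<^sup>+x. h (c + x) \<partial>lborel) = (\<integral>\<^sup>+x. h x \<partial>lborel)"
    if [measurable]: "h \<in> borel_measurable borel" for h :: "'a \<Rightarrow> ennreal" and c
  proof -
    have "(\<integral>\<^sup>+x. h x \<partial>lborel) = (\<integral>\<^sup>+x. h x \<partial>distr lborel borel ((+) c))"
      by (simp add: lborel_distr_plus)
    also have "\<dots> = (\<integral>\<^sup>+x. h (c + x) \<partial>lborel)"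
      by (subst nn_integral_distr) auto
    finally show ?thesis ..
  qed
  \<comment> \<open>The product of the two volumes becomes a double integral, which translations and
    Fubini transform until the volume of the ball splits off again, now next to that of the preimage
    of \<open>A\<close>.\<close>
  have "emeasure lborel ?B * emeasure lborel A = (\<integral>\<^sup>+x. \<integral>\<^sup>+y. indicator ?B x * indicator A y \<partial>lborel \<partial>lborel)"
  proof -
    have "emeasure lborel ?B * emeasure lborel A = (\<integral>\<^sup>+x. emeasure lborel A * indicator ?B x \<partial>lborel)"
      by (subst nn_integral_cmult_indicator) (simp_all add: mult.commute)
    also have "\<dots> = (\<integral>\<^sup>+x. indicator ?B x * (\<integral>\<^sup>+y. indicator A y \<partial>lborel) \<partial>lborel)"
      using A by (simp add: mult.commute)
    also have "\<dots> = (\<integral>\<^sup>+x. \<integral>\<^sup>+y. indicator ?B x * indicator A y \<partial>lborel \<partial>lborel)"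
      by (intro nn_integral_cong nn_integral_cmult[symmetric]) simp
    finally show ?thesis .
  qed
  \<comment> \<open>As \<open>f\<close> preserves the norm, \<open>x\<close> may become
    \<open>f x\<close> in the indicator of the ball; \<open>y\<close> is translated by
    \<open>f x\<close>.\<close>
  also have "\<dots> = (\<integral>\<^sup>+x. \<integral>\<^sup>+y. indicator ?B (f x) * indicator A (f x + y) \<partial>lborel \<partial>lborel)"
  proof (rule nn_integral_cong)
    fix x
    show "(\<integral>\<^sup>+y. indicator ?B x * indicator A y \<partial>lborel) =
      (\<integral>\<^sup>+y. indicator ?B (f x) * indicator A (f x + y) \<partial>lborel :: ennreal)"
      by (subst translate[of "\<lambda>y. indicator ?B (f x) * indicator A y"]) (simp_all add: nf indicator_def A)
  qed
  also have "\<dots> = (\<integral>\<^sup>+y. \<integral>\<^sup>+x. indicator ?B (f x) * indicator A (f x + y) \<partial>lborel \<partial>lborel)"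
    by (rule lborel_pair.Fubini') measurable
  \<comment> \<open>Translating \<open>x\<close> by \<open>g y\<close> shifts \<open>f x\<close> by
    \<open>y\<close>, because \<open>f\<close> is linear and \<open>f (g y) = y\<close>.\<close>
  also have "\<dots> = (\<integral>\<^sup>+y. \<integral>\<^sup>+x. indicator ?B (f x - y) * indicator A (f x) \<partial>lborel \<partial>lborel)"
  proof (rule nn_integral_cong)
    fix y
    have "(\<lambda>x. indicator ?B (f x - y) * indicator A (f x) :: ennreal) \<in> borel_measurable borel"
      by measurable
    from translate[OF this, of "g y"]
    show "(\<integral>\<^sup>+x. indicator ?B (f x) * indicator A (f x + y) \<partial>lborel) =
      (\<integral>\<^sup>+x. indicator ?B (f x - y) * indicator A (f x) \<partial>lborel :: ennreal)"
      by (simp add: linear_add[OF lin] g add.commute)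
  qed
  also have "\<dots> = (\<integral>\<^sup>+x. \<integral>\<^sup>+y. indicator ?B (f x - y) * indicator A (f x) \<partial>lborel \<partial>lborel)"
    by (rule lborel_pair.Fubini'[symmetric]) measurable
  also have "\<dots> = (\<integral>\<^sup>+x. \<integral>\<^sup>+y. indicator (f -` A) x * indicator (ball (f x) 1) y \<partial>lborel \<partial>lborel)"
    by (intro nn_integral_cong) (auto simp: indicator_def dist_norm norm_minus_commute)
  also have "\<dots> = (\<integral>\<^sup>+x. emeasure lborel ?B * indicator (f -` A) x \<partial>lborel)"
    by (intro nn_integral_cong) (simp add: nn_integral_cmult_indicator emeasure_ball mult.commute)
  also have "\<dots> = emeasure lborel ?B * emeasure lborel (f -` A)"
    using measurable_sets_borel[of f borel A] by (simp add: nn_integral_cmult_indicator)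
  finally show ?thesis
    using less_imp_neq[OF unit_ball_vol_pos[of "real DIM('a)"]]
    by (simp add: emeasure_ball ennreal_mult_cancel_left)
qed

text \<open>Splitting \<open>y - c\<close> along \<open>u\<close> gives coefficient 4 along
  \<open>u\<close> and 1 orthogonally, so the semi-axes are 1/4 and 1/2. After a translation and a
  rotation onto a coordinate axis, a diagonal map of determinant 2^(d+1) carries the spheroid onto
  the unit ball.\<close>

lemma measure_spheroid:
  fixes u c :: "real ^ 'n"
  assumes "norm u = 1"
  shows "measure lborel {y. (norm (y - c))\<^sup>2 + 3 * ((y - c) \<bullet> u)\<^sup>2 < 1/4} = unit_ball_vol CARD('n) / 2 ^ (CARD('n) + 1)"
proof -
  define E where "E u = {y. (norm y)\<^sup>2 + 3 * (y \<bullet> u)\<^sup>2 < 1/4}" for u :: "real ^ 'n"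
  have E [measurable]: "E u \<in> sets borel" for u
    unfolding E_def by measurable
  obtain k :: 'n where True by simp
  define e where "e = axis k (1::real)"
  have e: "e \<in> Basis" "norm e = 1" by (simp_all add: e_def axis_in_Basis_iff)
  obtain f where f: "orthogonal_transformation f" "f e = u"
    using orthogonal_transformation_exists[of e u] assms e by auto
  have "f -` E u = E e"
    using f by (force simp: E_def orthogonal_transformation_norm orthogonal_transformation_def)
  then have rot: "emeasure lborel (E u) = emeasure lborel (E e)"
    using emeasure_lborel_vimage_orthogonal[OF f(1) E] by metis
  \<comment> \<open>The factors are the reciprocals of the semi-axes. The summand 0 in
    \<open>S\<close> below is the offset of the affine change of variables.\<close>
  define m :: "real ^ 'n \<Rightarrow> real" where "m j = (if j = e then 4 else 2)" for j
  define S where "S y = 0 + (\<Sum>j\<in>Basis. (m j * (y \<bullet> j)) *\<^sub>R j)" for y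
  have [measurable]: "S \<in> borel_measurable borel"
    unfolding S_def by measurable
  have lb: "lborel = density (distr lborel borel S) (\<lambda>_. (\<Prod>j\<in>Basis. \<bar>m j\<bar>))"
    unfolding S_def by (rule lborel_affine_euclidean) (simp add: m_def)
  have "(norm (S y))\<^sup>2 = 4 * (norm y)\<^sup>2 + 12 * (y \<bullet> e)\<^sup>2" for y
  proof -
    have "(norm (S y))\<^sup>2 = (\<Sum>j\<in>Basis. (m j * (y \<bullet> j))\<^sup>2)"
      unfolding power2_norm_eq_inner by (subst euclidean_inner) (simp add: S_def power2_eq_square)
    also have "\<dots> = (\<Sum>j\<in>Basis. 4 * (y \<bullet> j)\<^sup>2 + (if j = e then 12 * (y \<bullet> e)\<^sup>2 else 0))"
      by (intro sum.cong) (auto simp: m_def power_mult_distrib)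
    also have "\<dots> = 4 * (norm y)\<^sup>2 + 12 * (y \<bullet> e)\<^sup>2"
      using e unfolding power2_norm_eq_inner
      by (subst euclidean_inner) (simp add: sum.distrib sum_distrib_left[symmetric] power2_eq_square)
    finally show ?thesis .
  qed
  then have "norm (S y) < 1 \<longleftrightarrow> 4 * (norm y)\<^sup>2 + 12 * (y \<bullet> e)\<^sup>2 < 1" for y
    by (metis abs_square_less_1 abs_norm_cancel)
  then have vim: "S -` ball 0 1 = E e"
    by (auto simp: E_def)
  have prod: "(\<Prod>j\<in>Basis. \<bar>m j\<bar>) = 2 ^ (CARD('n) + 1)"
  proof -
    have "(\<Prod>j\<in>Basis. \<bar>m j\<bar>) = (\<Prod>j\<in>Basis. 2 * (if j = e then 2 else 1))"
      by (intro prod.cong) (auto simp: m_def)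
    also have "\<dots> = 2 ^ (CARD('n) + 1)"
      using e by (simp add: prod.distrib)
    finally show ?thesis .
  qed
  have "ennreal (unit_ball_vol CARD('n)) = emeasure lborel (ball 0 1 :: (real ^ 'n) set)"
    by (simp add: emeasure_ball)
  also have "\<dots> = emeasure (density (distr lborel borel S) (\<lambda>_. ennreal (2 ^ (CARD('n) + 1)))) (ball 0 1)"
    using arg_cong[OF lb, of "\<lambda>M. emeasure M (ball 0 1)"] unfolding prod .
  also have "\<dots> = ennreal (2 ^ (CARD('n) + 1)) * emeasure lborel (E e)"
    by (simp add: emeasure_density_const emeasure_distr vim del: power_Suc)
  finally have "unit_ball_vol CARD('n) = 2 ^ (CARD('n) + 1) * measure lborel (E u)"
    unfolding rot[symmetric] measure_def by (metis enn2real_ennreal enn2real_mult unit_ball_vol_nonneg of_nat_0_le_iff zero_le_numeral zero_le_power)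
  moreover have "{y. (norm (y - c))\<^sup>2 + 3 * ((y - c) \<bullet> u)\<^sup>2 < 1/4} \<in> sets borel"
    by measurable
  then have "measure (distr lborel borel ((+) c)) {y. (norm (y - c))\<^sup>2 + 3 * ((y - c) \<bullet> u)\<^sup>2 < 1/4} = measure lborel (E u)"
    by (subst measure_distr) (simp_all add: E_def)
  ultimately show ?thesis
    by (simp add: lborel_distr_plus field_simps)
qed

section \<open>The integral of the kernel over an annulus\<close>

lemma annulus_eq: "{y. a \<le> norm (x - y) \<and> norm (x - y) \<le> b} = cball x b - ball x a"
  by (auto simp: dist_norm)

lemma integrable_annulus_kernel:
  fixes x :: "'a::euclidean_space"
  assumes "0 < a"
  shows "set_integrable lborel {y. a \<le> norm (x - y) \<and> norm (x - y) \<le> b} (\<lambda>y. 1 / norm (x - y) powr s)"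
proof -
  have "compact (cball x b - ball x a)"
    by (intro compact_diff) auto
  moreover have "continuous_on (cball x b - ball x a) (\<lambda>y. 1 / norm (x - y) powr s)"
    using assms by (intro continuous_intros) (auto simp: dist_norm)
  ultimately show ?thesis
    unfolding set_integrable_def annulus_eq by (intro borel_integrable_compact)
qed

text \<open>
  Comparing the kernel with its maximum on a single shell is sharp to first order in the width of
  the shell, and the right-hand side telescopes over shells of geometrically growing radii.
\<close>
lemma annulus_kernel_integral_le:
  fixes x :: "'a::euclidean_space" and \<alpha> :: real
  assumes "0 < \<alpha>" "0 < a" "a < b"
  shows "(LINT y : {y. a \<le> norm (x - y) \<and> norm (x - y) \<le> b} | lborel. 1 / norm (x - y) powr (DIM('a) + \<alpha>))
    \<le> unit_ball_vol DIM('a) * DIM('a) / \<alpha> * (a powr -\<alpha> - b powr -\<alpha>)"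
proof -
  define n where "n = DIM('a)"
  define A where "A p q = {y. p \<le> norm (x - y) \<and> norm (x - y) \<le> q}" for p q
  define w where "w y = 1 / norm (x - y) powr (n + \<alpha>)" for y
  define J where "J p q = (LINT y : A p q | lborel. w y)" for p q
  define c where "c = unit_ball_vol n"
  \<comment> \<open>The shell from \<open>p\<close> to \<open>q * p\<close> contributes at most
    \<open>c * (q ^ n - 1) * p powr -\<alpha>\<close>. Dividing by
    \<open>1 - q powr -\<alpha>\<close> rewrites this as a multiple of a difference of powers, with
    a factor \<open>c * g q\<close> that is the same for every \<open>p\<close>, so that the sum
    telescopes.\<close>
  define g where "g q = (q ^ n - 1) / (1 - q powr -\<alpha>)" for q :: real
  have A_eq: "A p q = cball x q - ball x p" for p q
    by (simp add: A_def annulus_eq)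
  have int: "set_integrable lborel (A p q) w" if "0 < p" for p q
    unfolding A_def w_def using that by (rule integrable_annulus_kernel)
  have shell: "J p (q * p) \<le> c * g q * (p powr -\<alpha> - (q * p) powr -\<alpha>)" if "0 < p" "1 < q" for p q
  proof -
    have "J p (q * p) \<le> (LINT y : A p (q * p) | lborel. 1 / p powr (n + \<alpha>))"
      unfolding J_def
    proof (rule set_integral_mono[OF int])
      show "set_integrable lborel (A p (q * p)) (\<lambda>y. 1 / p powr (n + \<alpha>))"
        unfolding A_eq set_integrable_def
        by (intro borel_integrable_compact compact_diff continuous_on_const) auto
      show "w y \<le> 1 / p powr (n + \<alpha>)" if "y \<in> A p (q * p)" for y
        using that \<open>0 < p\<close> assms by (auto simp: A_def w_def intro!: divide_left_mono powr_mono2 mult_pos_pos)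
    qed fact
    also have "\<dots> = measure lborel (cball x (q * p) - ball x p) * (1 / p powr (n + \<alpha>))"
      by (simp add: set_lebesgue_integral_def A_eq)
    also have "measure lborel (cball x (q * p) - ball x p) = measure lborel (cball x (q * p)) - measure lborel (ball x p)"
    proof (rule measure_Diff)
      have "p \<le> q * p" using that by simp
      then show "ball x p \<subseteq> cball x (q * p)" by auto
    qed (use that in \<open>auto simp: emeasure_cball\<close>)
    also have "\<dots> = c * (q ^ n - 1) * p ^ n"
      using that by (simp add: content_cball content_ball c_def n_def field_simps)
    also have "\<dots> * (1 / p powr (n + \<alpha>)) = c * (q ^ n - 1) * p powr -\<alpha>"
      using that by (simp add: powr_add powr_realpow powr_minus field_simps)
    also have "\<dots> = c * g q * (p powr -\<alpha> - (q * p) powr -\<alpha>)"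
    proof -
      have "q powr -\<alpha> < 1"
        using that assms by (simp add: powr_less_one)
      then have "g q * (1 - q powr -\<alpha>) = q ^ n - 1"
        by (simp add: g_def)
      moreover have "p powr -\<alpha> - (q * p) powr -\<alpha> = (1 - q powr -\<alpha>) * p powr -\<alpha>"
        using that by (simp add: powr_mult algebra_simps)
      ultimately show ?thesis
        by (metis mult.assoc)
    qed
    finally show ?thesis .
  qed
  \<comment> \<open>The common sphere is counted twice, so the integrands satisfy an inequality,
    which is enough for an upper bound.\<close>
  have split: "J p r \<le> J p q + J q r" if "0 < p" "p \<le> q" "q \<le> r" for p q r
  proof -
    have "J p r \<le> (\<integral>y. indicator (A p q) y *\<^sub>R w y + indicator (A q r) y *\<^sub>R w y \<partial>lborel)"
      unfolding J_def set_lebesgue_integral_def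
      using int[of p] int[of q] that unfolding set_integrable_def
      by (intro integral_mono) (auto simp: A_def w_def indicator_def)
    also have "\<dots> = J p q + J q r"
      using int[of p] int[of q] that unfolding set_integrable_def J_def set_lebesgue_integral_def
      by (intro Bochner_Integration.integral_add) auto
    finally show ?thesis .
  qed
  have tele: "J a (q ^ Suc m * a) \<le> c * g q * (a powr -\<alpha> - (q ^ Suc m * a) powr -\<alpha>)" if "1 < q" for q m
  proof (induction m)
    case 0
    show ?case using shell[of a q] that assms by simp
  next
    case (Suc m)
    define b' where "b' = q ^ Suc m * a"
    have "a \<le> b'"
      using that assms one_le_power[of q "Suc m"] by (simp add: b'_def del: power_Suc)
    have "J a (q * b') \<le> J a b' + J b' (q * b')"
      using \<open>a \<le> b'\<close> that assms by (intro split) auto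
    also have "\<dots> \<le> c * g q * (a powr -\<alpha> - b' powr -\<alpha>) + c * g q * (b' powr -\<alpha> - (q * b') powr -\<alpha>)"
      using \<open>a \<le> b'\<close> that assms Suc.IH by (intro add_mono shell) (auto simp: b'_def)
    finally show ?case by (simp add: b'_def algebra_simps)
  qed
  \<comment> \<open>With ratio \<open>exp (l / Suc m)\<close>, exactly \<open>Suc m\<close> shells
    lead from \<open>a\<close> to \<open>b\<close>; the ratio tends to 1 as \<open>m\<close>
    grows.\<close>
  define l where "l = ln (b / a)"
  have l: "0 < l" using assms by (simp add: l_def)
  have "J a b \<le> c * g (exp (l / Suc m)) * (a powr -\<alpha> - b powr -\<alpha>)" for m
  proof -
    have "exp (l / Suc m) ^ Suc m * a = b"
      using assms by (simp only: exp_of_nat_mult[symmetric]) (simp add: l_def)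
    then show ?thesis
      using tele[of "exp (l / Suc m)" m] l by (simp del: power_Suc of_nat_Suc)
  qed
  moreover have "(\<lambda>m. c * g (exp (l / Suc m)) * (a powr -\<alpha> - b powr -\<alpha>)) \<longlonglongrightarrow> c * (n / \<alpha>) * (a powr -\<alpha> - b powr -\<alpha>)"
  proof -
    \<comment> \<open>This is the limit of \<open>g\<close> at ratio 1, computed as a quotient of
      two derivatives of exponentials at 0.\<close>
    have "(\<lambda>m. (exp (real n * (l / Suc m)) - 1) / (1 - exp (- \<alpha> * (l / Suc m)))) \<longlonglongrightarrow> n / \<alpha>"
    proof -
      have h: "filterlim (\<lambda>m. l / real (Suc m)) (at 0) sequentially"
        using l by (auto intro!: filterlim_atI tendsto_divide_0[OF tendsto_const] filterlim_at_top_imp_at_infinity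
          filterlim_compose[OF filterlim_real_sequentially filterlim_Suc] simp del: of_nat_Suc)
      have exp_quot: "((\<lambda>h. (exp (k * h) - 1) / h) \<longlongrightarrow> k) (at 0)" for k :: real
      proof -
        have "((\<lambda>h. exp (k * h)) has_field_derivative k) (at 0)"
          by (auto intro!: derivative_eq_intros)
        then show ?thesis by (simp add: DERIV_def)
      qed
      have "((\<lambda>h. (1 - exp (- \<alpha> * h)) / h) \<longlongrightarrow> \<alpha>) (at 0)"
        using tendsto_minus[OF exp_quot[of "- \<alpha>"]] by (simp add: minus_divide_left)
      from tendsto_divide[OF exp_quot[of "real n"] this]
      have "((\<lambda>h. ((exp (real n * h) - 1) / h) / ((1 - exp (- \<alpha> * h)) / h)) \<longlongrightarrow> real n / \<alpha>) (at 0)"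
        using \<open>0 < \<alpha>\<close> by simp
      from filterlim_compose[OF this h] show ?thesis
        using l by (simp add: o_def)
    qed
    then show ?thesis
      by (intro tendsto_intros) (simp add: g_def powr_def exp_of_nat_mult[symmetric] mult_ac)
  qed
  ultimately show ?thesis
    using LIMSEQ_le_const[of _ _ "J a b"] by (simp add: J_def A_def w_def n_def c_def mult_ac)
qed

section \<open>The spheroid inside the intersection of two balls\<close>

text \<open>With \<open>a = norm x - 3/4\<close> and \<open>c = w \<bullet> u\<close>, the point is
  a u + w and |w|^2 < 1/4 - 3 c^2, so both claims reduce to quadratic inequalities in
  \<open>c\<close>.\<close>

lemma spheroid_subset_lens:
  fixes x y :: "'a::real_inner"
  defines "u \<equiv> x /\<^sub>R norm x"
  defines "w \<equiv> y - (x - (3/4) *\<^sub>R u)"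
  assumes "3/2 \<le> norm x" and w: "(norm w)\<^sup>2 + 3 * (w \<bullet> u)\<^sup>2 < 1/4"
  shows "norm y \<le> norm x - 1/2" "norm (x - y) \<le> 1"
proof -
  define a where "a = norm x - 3/4"
  define c where "c = w \<bullet> u"
  have u: "u \<bullet> u = 1" and x: "x = norm x *\<^sub>R u"
  proof -
    have "norm x \<noteq> 0" using assms(3) by auto
    then have "norm u = 1" "norm x *\<^sub>R u = x" by (simp_all add: u_def)
    then show "u \<bullet> u = 1" "x = norm x *\<^sub>R u" by (simp_all add: norm_eq_1)
  qed
  have "c\<^sup>2 \<le> (norm w)\<^sup>2"
    using Cauchy_Schwarz_ineq[of w u] by (simp add: c_def u power2_norm_eq_inner)
  then have "c\<^sup>2 \<le> (1/4)\<^sup>2"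
    using w by (simp add: c_def power2_eq_square)
  then have c: "\<bar>c\<bar> \<le> 1/4"
    by (simp flip: abs_le_square_iff)
  have "y = a *\<^sub>R u + w"
    using x[symmetric] by (simp add: w_def a_def scaleR_diff_left)
  then have "(norm y)\<^sup>2 = a\<^sup>2 + 2 * a * c + (norm w)\<^sup>2"
    unfolding power2_norm_eq_inner c_def
    by (simp add: inner_simps u inner_commute[of u w] power2_eq_square algebra_simps)
  \<comment> \<open>The second factor is nonnegative for all \<open>c \<le> 1/4\<close> because
    \<open>a \<ge> 3/4\<close>, which is the hypothesis \<open>3/2 \<le> norm x\<close>.\<close>
  also have "\<dots> \<le> (norm x - 1/2)\<^sup>2 - (1/4 - c) * (2 * a - 3 * (1/4 + c))"
    using w by (simp add: a_def c_def[symmetric] power2_eq_square algebra_simps diff_divide_distrib)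
  also have "\<dots> \<le> (norm x - 1/2)\<^sup>2"
    using c assms by (simp add: a_def)
  finally show "norm y \<le> norm x - 1/2"
    using assms by (auto intro: power2_le_imp_le)
  have "x - y = (3/4) *\<^sub>R u - w"
    by (simp add: w_def)
  then have "(norm (x - y))\<^sup>2 = 9/16 - 3/2 * c + (norm w)\<^sup>2"
    unfolding power2_norm_eq_inner c_def
    by (simp add: inner_simps u inner_commute[of u w] diff_divide_distrib)
  also have "\<dots> \<le> 1\<^sup>2 - 3 * (c + 1/4)\<^sup>2"
    using w by (simp add: c_def[symmetric] power2_eq_square algebra_simps)
  also have "\<dots> \<le> 1\<^sup>2"
    by simp
  finally show "norm (x - y) \<le> 1"
    by (rule power2_le_imp_le) simp
qed

section \<open>Bounds on balls around the origin\<close>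

lemma locally_bounded_imp_bounded_image:
  assumes "locally_bounded f" "compact K"
  shows "bounded (f ` K)"
proof -
  obtain U where U: "\<forall>x. open (U x) \<and> x \<in> U x \<and> bounded (f ` U x)"
    using choice[OF assms(1)[unfolded locally_bounded_def]] by (elim exE)
  obtain F where "finite F" "K \<subseteq> (\<Union>x\<in>F. U x)"
  proof (rule compactE_image[OF assms(2), of K U])
    show "K \<subseteq> (\<Union>x\<in>K. U x)" using U by blast
  qed (use U in auto)
  then have "bounded (\<Union>x\<in>F. f ` U x)" "f ` K \<subseteq> f ` (\<Union>x\<in>F. U x)"
    using U by (auto intro: image_mono)
  then show ?thesis
    by (metis bounded_subset image_UN)
qed

lemma bounded_image_cballE:
  fixes f :: "'a::real_normed_vector \<Rightarrow> real"
  assumes "bounded (f ` cball 0 r)"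
  obtains M where "\<And>z. norm z \<le> r \<Longrightarrow> \<bar>f z\<bar> \<le> M"
proof -
  obtain M where "\<forall>y\<in>f ` cball 0 r. norm y \<le> M"
    using assms unfolding bounded_iff by blast
  then show thesis
    by (intro that[of M]) simp
qed

lemma inf_inner_le:
  assumes "norm x - 1 \<le> norm z" "norm z \<le> norm x - 1/2"
  shows "inf_inner V x \<le> exp (- V z)"
  unfolding inf_inner_def using assms
  by (intro cINF_lower bdd_belowI[of _ 0]) auto

text \<open>A real supremum dominates its members only if the set is bounded above; local
  boundedness of \<open>V\<close> on a compact ball provides this.\<close>

lemma le_sup_outer:
  assumes "locally_bounded V" "norm x \<le> norm z" "norm z \<le> norm x + 1"
  shows "exp (- V z) \<le> sup_outer V x"
proof -
  obtain M where M: "\<And>z. norm z \<le> norm x + 1 \<Longrightarrow> \<bar>V z\<bar> \<le> M"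
    using bounded_image_cballE[OF locally_bounded_imp_bounded_image[OF assms(1) compact_cball]] by blast
  have "- V z \<le> M" if "norm z \<le> norm x + 1" for z
    using M[OF that] by linarith
  then show ?thesis
    unfolding sup_outer_def using assms
    by (intro cSUP_upper bdd_aboveI[of _ "exp M"]) auto
qed

text \<open>The singularity of the kernel is kept away by \<open>1/2 \<le> norm (x - y)\<close>.
  Uniformity in \<open>x\<close> serves the bound of the operator on a ball; for a single
  \<open>x\<close> the bound yields integrability.\<close>

lemma integrand_bounded:
  fixes V \<phi> :: "real ^ 'n \<Rightarrow> real"
  assumes "0 < s" "locally_bounded V" "continuous_on UNIV \<phi>"
  obtains B where "0 \<le> B" and "\<And>x y. norm x \<le> r \<Longrightarrow> 1/2 \<le> norm (x - y) \<Longrightarrow> norm (x - y) \<le> 1 \<Longrightarrow>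
    \<bar>(\<phi> y - \<phi> x) * ((1 + exp (V x - V y)) / norm (x - y) powr s)\<bar> \<le> B"
proof -
  obtain M where M: "\<And>z. norm z \<le> r + 1 \<Longrightarrow> \<bar>V z\<bar> \<le> M"
    using bounded_image_cballE[OF locally_bounded_imp_bounded_image[OF assms(2) compact_cball]] by blast
  have "bounded (\<phi> ` cball 0 (r + 1))"
    using assms(3) by (intro compact_imp_bounded compact_continuous_image compact_cball)
      (auto intro: continuous_on_subset)
  then obtain N where N: "\<And>z. norm z \<le> r + 1 \<Longrightarrow> \<bar>\<phi> z\<bar> \<le> N"
    by (rule bounded_image_cballE) blast
  show thesis
  proof
    \<comment> \<open>The absolute value makes the bound nonnegative also for
      \<open>r + 1 < 0\<close>, when nothing constrains \<open>N\<close>.\<close>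
    show "0 \<le> \<bar>N + N\<bar> * ((1 + exp (M + M)) / (1/2) powr s)"
      by (simp add: add_nonneg_nonneg)
    fix x y :: "real ^ 'n"
    assume xy: "norm x \<le> r" "1/2 \<le> norm (x - y)" "norm (x - y) \<le> 1"
    have x: "norm x \<le> r + 1" and y: "norm y \<le> r + 1"
      using xy norm_triangle_ineq4[of x "x - y"] by auto
    have "(1/2) powr s \<le> norm (x - y) powr s"
      using xy assms by (intro powr_mono2) auto
    moreover have "V x - V y \<le> M + M" "\<bar>\<phi> y - \<phi> x\<bar> \<le> \<bar>N + N\<bar>"
      using M[OF x] M[OF y] N[OF x] N[OF y] by linarith+
    ultimately have "\<bar>\<phi> y - \<phi> x\<bar> * ((1 + exp (V x - V y)) / norm (x - y) powr s)
        \<le> \<bar>N + N\<bar> * ((1 + exp (M + M)) / (1/2) powr s)"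
      by (intro mult_mono frac_le) (auto simp: add_nonneg_nonneg)
    then show "\<bar>(\<phi> y - \<phi> x) * ((1 + exp (V x - V y)) / norm (x - y) powr s)\<bar>
        \<le> \<bar>N + N\<bar> * ((1 + exp (M + M)) / (1/2) powr s)"
      by (simp add: abs_mult add_nonneg_nonneg abs_of_nonneg[of "1 + exp _"])
  qed
qed

lemma L_trunc_bounded_above:
  fixes V \<phi> :: "real ^ 'n \<Rightarrow> real"
  assumes "0 < \<alpha>" "locally_bounded V" "continuous_on UNIV \<phi>"
  obtains B where "\<And>x. norm x \<le> r \<Longrightarrow> L_trunc \<alpha> V \<phi> x \<le> B"
proof -
  obtain B where B: "0 \<le> B" "\<And>x y. norm x \<le> r \<Longrightarrow> 1/2 \<le> norm (x - y) \<Longrightarrow> norm (x - y) \<le> 1 \<Longrightarrow>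
    \<bar>(\<phi> y - \<phi> x) * ((1 + exp (V x - V y)) / norm (x - y) powr (real CARD('n) + \<alpha>))\<bar> \<le> B"
    using integrand_bounded[of "real CARD('n) + \<alpha>" V \<phi> r] assms by auto
  have "L_trunc \<alpha> V \<phi> x \<le> 1/2 * (B * unit_ball_vol CARD('n))" if "norm x \<le> r" for x
  proof -
    have "(LINT y : {y. 1/2 \<le> norm (x - y) \<and> norm (x - y) \<le> 1} | lborel.
        (\<phi> y - \<phi> x) * ((1 + exp (V x - V y)) / norm (x - y) powr (real CARD('n) + \<alpha>)))
      \<le> (\<integral>y. indicator (cball x 1) y *\<^sub>R B \<partial>lborel)"
      unfolding set_lebesgue_integral_def
    \<comment> \<open>Integrability is asked of the majorant, whose nonnegativity covers the default
      value 0 of the integral on the left; hence the claim \<open>0 \<le> B\<close>.\<close>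
    proof (rule integral_mono')
      show "integrable lborel (\<lambda>y. indicator (cball x 1) y *\<^sub>R B)"
        by (intro borel_integrable_compact) auto
      show "indicator {y. 1/2 \<le> norm (x - y) \<and> norm (x - y) \<le> 1} y *\<^sub>R
          ((\<phi> y - \<phi> x) * ((1 + exp (V x - V y)) / norm (x - y) powr (real CARD('n) + \<alpha>)))
          \<le> indicator (cball x 1) y *\<^sub>R B" for y
        using B(1) abs_le_D1[OF B(2)[OF that, of y]] by (auto simp: indicator_def dist_norm)
    qed (use B in auto)
    also have "\<dots> = B * unit_ball_vol CARD('n)"
      by (simp add: content_cball)
    finally show ?thesis
      by (simp add: L_trunc_def)
  qed
  then show thesis by (rule that)
qed

text \<open>This lets the constant \<open>b\<close> of the theorem absorb the negative term inside a
  ball.\<close>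

lemma weighted_inf_inner_bounded_above:
  fixes V \<phi> :: "real ^ 'n \<Rightarrow> real"
  assumes "locally_bounded V" "continuous_on UNIV \<phi>" "\<And>x. 0 \<le> \<phi> x"
  obtains B where "\<And>x. norm x \<le> r \<Longrightarrow> exp (V x) * inf_inner V x * \<phi> x \<le> B"
proof -
  obtain M where M: "\<And>z. norm z \<le> r \<Longrightarrow> \<bar>V z\<bar> \<le> M"
    using bounded_image_cballE[OF locally_bounded_imp_bounded_image[OF assms(1) compact_cball]] by blast
  have "bounded (\<phi> ` cball 0 r)"
    using assms(2) by (intro compact_imp_bounded compact_continuous_image compact_cball)
      (auto intro: continuous_on_subset)
  then obtain N where N: "\<And>z. norm z \<le> r \<Longrightarrow> \<bar>\<phi> z\<bar> \<le> N"
    by (rule bounded_image_cballE) blast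
  \<comment> \<open>The second summand covers \<open>norm x < 1/2\<close>, where
    \<open>inf_inner V x\<close> is \<open>Inf {}\<close>.\<close>
  define I where "I = exp M + \<bar>Inf {}\<bar>"
  have "exp (V x) * inf_inner V x * \<phi> x \<le> exp M * I * N" if x: "norm x \<le> r" for x
  proof -
    have "inf_inner V x \<le> I"
    proof (cases "norm x < 1/2")
      case True
      then have e: "{z. norm x - 1 \<le> norm z \<and> norm z \<le> norm x - 1/2} = {}"
        using order_trans[OF norm_ge_zero] by fastforce
      then have "inf_inner V x = Inf {}"
        by (simp only: inf_inner_def e image_empty)
      then show ?thesis by (simp add: I_def add_increasing)
    next
      case False
      \<comment> \<open>A witness on the ray through \<open>x\<close>, on the outer boundary of the
        set of the infimum; for \<open>norm x = 1/2\<close> it is the origin.\<close>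
      define z where "z = ((norm x - 1/2) / norm x) *\<^sub>R x"
      have z: "norm z = norm x - 1/2"
        using False by (cases "x = 0") (auto simp: z_def)
      then have "inf_inner V x \<le> exp (- V z)"
        by (intro inf_inner_le) auto
      also have "\<dots> \<le> exp M"
        using M[of z] z x by auto
      also have "\<dots> \<le> I"
        by (simp add: I_def)
      finally show ?thesis .
    qed
    moreover have "0 \<le> I" by (simp add: I_def)
    ultimately have "exp (V x) * inf_inner V x * \<phi> x \<le> exp (V x) * I * \<phi> x"
      using assms(3) by (intro mult_right_mono mult_left_mono) auto
    also have "\<dots> \<le> exp M * I * N"
      using M[OF x] N[OF x] assms(3)[of x] \<open>0 \<le> I\<close> by (intro mult_mono) auto
    finally show ?thesis .
  qed
  then show thesis by (rule that)
qed

section \<open>The main estimate away from the origin\<close>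

text \<open>On the annulus the integrand is at most \<open>p * w y - q * indicator S y\<close>: the
  first term bounds the outward jumps, the second is the gain from jumps into the spheroid
  \<open>S\<close>. Integration brings in the kernel bound and the volume of
  \<open>S\<close>.\<close>

lemma L_trunc_exp_norm_le:
  fixes V \<phi> :: "real ^ 'n \<Rightarrow> real" and x :: "real ^ 'n"
  assumes \<alpha>: "0 < \<alpha>" and V: "V \<in> borel_measurable borel" "locally_bounded V"
    and \<phi>: "continuous_on UNIV \<phi>" "\<And>x. norm x > 1 \<Longrightarrow> \<phi> x = exp (norm x)"
    and x: "2 < norm x" and K: "0 < K" "K \<le> inf_inner V x / sup_outer V x"
  defines "c \<equiv> unit_ball_vol CARD('n)"
  shows "L_trunc \<alpha> V \<phi> x \<le> 1/2 * (exp (V x) * inf_inner V x * \<phi> x *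
    (2 * (exp 1 - 1) / K * (c * CARD('n) / \<alpha> * (2 powr \<alpha> - 1)) - (1 - exp (- (1/2))) * (c / 2 ^ (CARD('n) + 1))))"
proof -
  define s where "s = real CARD('n) + \<alpha>"
  define A where "A = {y. 1/2 \<le> norm (x - y) \<and> norm (x - y) \<le> 1}"
  define F where "F y = (\<phi> y - \<phi> x) * ((1 + exp (V x - V y)) / norm (x - y) powr s)" for y
  define w where "w y = 1 / norm (x - y) powr s" for y
  define E where "E = exp (V x) * inf_inner V x"
  define u where "u = x /\<^sub>R norm x"
  define S where "S = {y. (norm (y - (x - (3/4) *\<^sub>R u)))\<^sup>2 + 3 * ((y - (x - (3/4) *\<^sub>R u)) \<bullet> u)\<^sup>2 < 1/4}"
  define p where "p = exp (norm x) * (exp 1 - 1) * (2 * E / K)"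
  define q where "q = exp (norm x) * (1 - exp (- (1/2))) * E"
  have [measurable]: "\<phi> \<in> borel_measurable borel" "V \<in> borel_measurable borel" "A \<in> sets borel" "S \<in> sets borel"
    using \<phi> V by (auto simp: borel_measurable_continuous_onI A_def annulus_eq S_def)
  have S: "norm y \<le> norm x - 1/2" "norm (x - y) \<le> 1" "y \<in> A" if "y \<in> S" for y
  proof -
    show y: "norm y \<le> norm x - 1/2" "norm (x - y) \<le> 1"
      using spheroid_subset_lens[of x y] that x by (auto simp: S_def u_def)
    then show "y \<in> A"
      using norm_triangle_ineq2[of x y] by (auto simp: A_def)
  qed
  have supK: "exp (- V y) \<le> inf_inner V x / K" if "norm x \<le> norm y" "norm y \<le> norm x + 1" for y
  proof -
    have "0 < sup_outer V x"
      using le_sup_outer[OF V(2), of x x] by (simp add: less_le_trans[OF exp_gt_zero])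
    then have "sup_outer V x \<le> inf_inner V x / K"
      using K by (simp add: field_simps)
    then show ?thesis
      using le_sup_outer[OF V(2) that] by linarith
  qed
  have VK: "exp (V x - V y) \<le> E / K" if "norm x \<le> norm y" "norm y \<le> norm x + 1" for y
    using mult_left_mono[OF supK[OF that], of "exp (V x)"] by (simp add: E_def exp_diff exp_minus field_simps)
  \<comment> \<open>Taking \<open>y = x\<close> shows that the summand 1 in the kernel is at most
    \<open>E / K\<close>, whence the factor 2 in \<open>p\<close>.\<close>
  have one: "1 \<le> E / K"
    using VK[of x] by simp
  then have E: "0 < E"
    using K by (simp add: field_simps)
  have pq: "0 \<le> p" "0 \<le> q"
    using E K by (auto simp: p_def q_def)
  have FA: "F y \<le> p * w y - q * indicator S y" if "y \<in> A" for y
  proof -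
    have yA: "1/2 \<le> norm (x - y)" "norm (x - y) \<le> 1"
      using that by (auto simp: A_def)
    have ny: "norm y \<le> norm x + 1" "norm x - 1 \<le> norm y"
      using yA norm_triangle_ineq2[of x y] norm_triangle_ineq2[of y x] by (auto simp: norm_minus_commute)
    \<comment> \<open>Since \<open>2 < norm x\<close>, every \<open>y\<close> in the annulus has
      norm above 1, where the exponential form of \<open>\<phi>\<close> is available.\<close>
    have \<phi>y: "\<phi> y = exp (norm y)" "\<phi> x = exp (norm x)"
      using ny x \<phi>(2) by auto
    have w: "1 \<le> w y"
      using yA \<alpha> powr_mono2[of s "norm (x - y)" 1] by (cases "x = y") (auto simp: w_def s_def le_divide_eq_1_pos)
    have F: "F y = (exp (norm y) - exp (norm x)) * ((1 + exp (V x - V y)) * w y)"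
      by (simp add: F_def w_def \<phi>y)
    \<comment> \<open>Inward jumps that miss \<open>S\<close> contribute a nonpositive amount, which
      is discarded.\<close>
    consider "norm x \<le> norm y" | "norm y < norm x" "y \<notin> S" | "y \<in> S" by linarith
    then show ?thesis
    proof cases
      case 1
      then have "y \<notin> S" using S(1)[of y] by auto
      have "exp (norm y) - exp (norm x) \<le> exp (norm x) * (exp 1 - 1)"
        using ny by (simp add: algebra_simps exp_add[symmetric])
      moreover have "1 + exp (V x - V y) \<le> 2 * E / K"
        using VK[OF 1 ny(1)] one by simp
      ultimately have "F y \<le> exp (norm x) * (exp 1 - 1) * (2 * E / K * w y)"
        unfolding F using w 1 E K by (intro mult_mono) (auto simp: add_nonneg_nonneg)
      then show ?thesis
        using \<open>y \<notin> S\<close> by (simp add: p_def mult.assoc)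
    next
      case 2
      then have "F y \<le> 0"
        unfolding F using w by (intro mult_nonpos_nonneg) (auto simp: add_nonneg_nonneg)
      moreover have "0 \<le> p * w y"
        using pq w by simp
      ultimately show ?thesis
        using 2 by simp
    next
      case 3
      have "exp (norm y) \<le> exp (norm x) * exp (- (1/2))"
        using S(1)[OF 3] by (simp add: exp_add[symmetric])
      then have 1: "exp (norm x) * (1 - exp (- (1/2))) \<le> exp (norm x) - exp (norm y)"
        by (simp add: algebra_simps)
      have "E \<le> exp (V x) * exp (- V y)"
        unfolding E_def using inf_inner_le[of x y V] S(1)[OF 3] ny by (intro mult_left_mono) auto
      then have "E \<le> 1 + exp (V x - V y)"
        by (simp flip: exp_add)
      also have "\<dots> \<le> (1 + exp (V x - V y)) * w y"
        using w mult_left_mono[of 1 "w y" "1 + exp (V x - V y)"] by (auto simp: add_nonneg_nonneg)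
      finally have "q \<le> (exp (norm x) - exp (norm y)) * ((1 + exp (V x - V y)) * w y)"
        unfolding q_def using 1 E S(1)[OF 3] by (intro mult_mono) auto
      then have "F y \<le> - q"
        by (simp add: F algebra_simps)
      moreover have "0 \<le> p * w y"
        using pq w by simp
      ultimately show ?thesis
        using 3 by simp
    qed
  qed
  have intF: "integrable lborel (\<lambda>y. indicator A y *\<^sub>R F y)"
  proof -
    obtain B where "0 \<le> B" and "\<And>x' y. norm x' \<le> norm x \<Longrightarrow> 1/2 \<le> norm (x' - y) \<Longrightarrow> norm (x' - y) \<le> 1 \<Longrightarrow>
      \<bar>(\<phi> y - \<phi> x') * ((1 + exp (V x' - V y)) / norm (x' - y) powr s)\<bar> \<le> B"
      using integrand_bounded[of s V \<phi> "norm x"] \<alpha> V(2) \<phi>(1) by (auto simp: s_def)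
    then have "\<bar>F y\<bar> \<le> B" if "y \<in> A" for y
      using that by (auto simp: A_def F_def)
    moreover have "emeasure lborel A < \<infinity>"
      unfolding A_def annulus_eq
      by (rule le_less_trans[OF emeasure_mono[of _ "cball x 1"]]) (auto simp: emeasure_cball)
    moreover have "F \<in> borel_measurable lborel"
      unfolding F_def by measurable
    ultimately show ?thesis
      by (intro integrableI_bounded_set_indicator[where B = B]) auto
  qed
  have intw: "integrable lborel (\<lambda>y. indicator A y *\<^sub>R w y)"
    using integrable_annulus_kernel[of "1/2" x 1 s] by (simp add: set_integrable_def A_def w_def)
  have "S \<subseteq> cball x 1"
    using S(2) by (auto simp: dist_norm)
  then have "emeasure lborel S < \<infinity>"
    by (rule le_less_trans[OF emeasure_mono[of _ "cball x 1"]]) (auto simp: emeasure_cball)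
  then have intS: "integrable lborel (indicator S :: _ \<Rightarrow> real)"
    by (intro integrable_real_indicator) auto
  have "(\<integral>y. indicator A y *\<^sub>R F y \<partial>lborel) \<le> (\<integral>y. p * (indicator A y *\<^sub>R w y) - q * indicator S y \<partial>lborel)"
  proof (rule integral_mono[OF intF])
    show "integrable lborel (\<lambda>y. p * (indicator A y *\<^sub>R w y) - q * indicator S y)"
      using intw intS by (intro Bochner_Integration.integrable_diff integrable_mult_right) auto
    \<comment> \<open>Off the annulus both sides vanish, since \<open>S\<close> is contained in
      \<open>A\<close>.\<close>
    show "indicator A y *\<^sub>R F y \<le> p * (indicator A y *\<^sub>R w y) - q * indicator S y" for y
      using FA[of y] S(3)[of y] by (auto simp: indicator_def)
  qed
  also have "\<dots> = p * (\<integral>y. indicator A y *\<^sub>R w y \<partial>lborel) - q * measure lborel S"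
    using intw intS by (subst Bochner_Integration.integral_diff) auto
  also have "\<dots> \<le> p * (c * CARD('n) / \<alpha> * (2 powr \<alpha> - 1)) - q * (c / 2 ^ (CARD('n) + 1))"
  proof -
    have "(\<integral>y. indicator A y *\<^sub>R w y \<partial>lborel) \<le> c * CARD('n) / \<alpha> * (2 powr \<alpha> - 1)"
      using annulus_kernel_integral_le[OF \<alpha>, of "1/2" 1 x]
      by (simp add: A_def w_def s_def c_def set_lebesgue_integral_def powr_minus powr_divide)
    moreover have "norm u = 1"
      using x by (cases "x = 0") (auto simp: u_def)
    then have "measure lborel S = c / 2 ^ (CARD('n) + 1)"
      unfolding S_def c_def by (rule measure_spheroid)
    ultimately show ?thesis
      using pq by (metis diff_right_mono mult_left_mono)
  qed
  also have "\<dots> = E * \<phi> x * (2 * (exp 1 - 1) / K * (c * CARD('n) / \<alpha> * (2 powr \<alpha> - 1)) - (1 - exp (- (1/2))) * (c / 2 ^ (CARD('n) + 1)))"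
    using \<phi>(2)[of x] x by (simp add: p_def q_def algebra_simps diff_divide_distrib)
  finally show ?thesis
    unfolding L_trunc_def set_lebesgue_integral_def A_def F_def E_def s_def by simp
qed

section \<open>Comparison of the constants and conclusion\<close>

theorem lemma3p3:
  fixes \<alpha> :: real and V \<phi> :: "real ^ 'n \<Rightarrow> real"
  assumes "0 < \<alpha>" and "\<alpha> < 2"
    and "V \<in> borel_measurable borel"
    and "locally_bounded V"
    and "integrable lborel (\<lambda>x. exp (- V x))"
    and "continuous_on UNIV \<phi>"
    and "\<And>x. \<phi> x > 1"
    and "\<And>x. norm x > 1 \<Longrightarrow> \<phi> x = exp (norm x)"
    and "Liminf at_infinity (\<lambda>x. ereal (inf_inner V x / sup_outer V x))
           > ereal (1 / \<alpha> * 2 ^ (2 * CARD('n) + 1) * (exp 1 + exp (1/2)) * (2 powr \<alpha> - 1))"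
  shows "\<exists>C1 b r0. C1 > 0 \<and> b > 0 \<and> r0 > 0 \<and>
           (\<forall>x. L_trunc \<alpha> V \<phi> x
                  \<le> - C1 * (exp (V x) * inf_inner V x) * \<phi> x + b * indicator (ball 0 r0) x)"
proof -
  define d where "d = CARD('n)"
  define c where "c = unit_ball_vol d"
  define K0 where "K0 = 1 / \<alpha> * 2 ^ (2 * d + 1) * (exp 1 + exp (1/2)) * (2 powr \<alpha> - 1)"
  note \<alpha> = assms(1) and V = assms(3,4) and \<phi> = assms(6,8)
  obtain K where K: "K0 < K" "ereal K < Liminf at_infinity (\<lambda>x. ereal (inf_inner V x / sup_outer V x))"
    using ereal_dense2[OF assms(9)] by (auto simp: K0_def d_def)
  have "0 < K0"
    using \<alpha> by (simp add: K0_def add_pos_pos)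
  then have "0 < K" using K by simp
  obtain r1 where r1: "\<And>x. r1 \<le> norm x \<Longrightarrow> K < inf_inner V x / sup_outer V x"
    using less_LiminfD[OF K(2)] by (auto simp: eventually_at_infinity)
  \<comment> \<open>The bound 3 guarantees \<open>2 < norm x\<close> for all \<open>x\<close> with
    \<open>r \<le> norm x\<close>.\<close>
  define r where "r = max r1 3"
  \<comment> \<open>The negative of the bracket in \<open>L_trunc_exp_norm_le\<close>; the factor
    1/2 of the operator then makes \<open>D / 2\<close> the constant \<open>C1\<close>.\<close>
  define D where "D = (1 - exp (- (1/2))) * (c / 2 ^ (d + 1)) - 2 * (exp 1 - 1) / K * (c * d / \<alpha> * (2 powr \<alpha> - 1))"
  have "0 < D"
  proof -
    \<comment> \<open>In terms of t the quotient (e - 1)/(e + e^(1/2)) is (t^2 - 1)/(t^2 + t) = 1 -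
      1/t, which matches the gain factor 1 - e^(-1/2).\<close>
    define t where "t = exp (1/2 :: real)"
    have t: "1 < t" "exp 1 = t\<^sup>2" "exp (- (1/2)) = 1 / t"
      by (auto simp: t_def exp_double[symmetric] exp_minus field_simps)
    obtain k where "d = Suc k"
      using zero_less_card_finite[where 'a = 'n] by (metis d_def gr0_conv_Suc)
    then have "d \<le> 2 ^ (d - 1)"
      by (simp add: Suc_leI)
    then have d: "real d \<le> 2 ^ (d - 1)"
      by (metis of_nat_le_iff of_nat_numeral of_nat_power)
    have "0 < d" by (simp add: d_def)
    \<comment> \<open>The strict inequality \<open>K0 < K\<close> is what makes \<open>D\<close>
      positive: the later comparison \<open>d \<le> 2 ^ (d - 1)\<close> is an equality for d = 1 and
      d = 2.\<close>
    have "2 * (exp 1 - 1) / K * (c * d / \<alpha> * (2 powr \<alpha> - 1)) < 2 * (exp 1 - 1) / K0 * (c * d / \<alpha> * (2 powr \<alpha> - 1))"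
      using K \<open>0 < K0\<close> \<alpha> \<open>0 < d\<close> by (intro mult_strict_right_mono divide_strict_left_mono) (auto simp: c_def)
    also have "\<dots> = (1 - exp (- (1/2))) * c * d / 2 ^ (2 * d)"
    proof -
      define h where "h = 2 powr \<alpha> - 1"
      have h: "0 < h" using \<alpha> by (simp add: h_def)
      have "2 * (exp 1 - 1) / K0 * (c * d / \<alpha> * (2 powr \<alpha> - 1)) = (t\<^sup>2 - 1) / (t\<^sup>2 + t) * c * d / 2 ^ (2 * d)"
        unfolding K0_def t_def[symmetric] h_def[symmetric] t(2) using \<alpha> t(1) h add_pos_pos[of "t\<^sup>2" t] by (simp add: divide_simps)
      also have "(t\<^sup>2 - 1) / (t\<^sup>2 + t) = 1 - 1 / t"
        using t(1) add_pos_pos[of "t\<^sup>2" t] by (simp add: divide_simps) (simp add: algebra_simps power2_eq_square)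
      finally show ?thesis by (simp add: t)
    qed
    also have "\<dots> \<le> (1 - exp (- (1/2))) * c * 2 ^ (d - 1) / 2 ^ (2 * d)"
      using d by (intro divide_right_mono mult_left_mono) (auto simp: c_def)
    also have "\<dots> = (1 - exp (- (1/2))) * (c / 2 ^ (d + 1))"
    proof -
      have "2 ^ (2 * d) = (2 :: real) ^ (d - 1) * 2 ^ (d + 1)"
        using \<open>0 < d\<close> by (simp only: power_add[symmetric]) simp
      then show ?thesis by simp
    qed
    finally show ?thesis by (simp add: D_def)
  qed
  have large: "L_trunc \<alpha> V \<phi> x \<le> - (D / 2) * (exp (V x) * inf_inner V x) * \<phi> x" if "r \<le> norm x" for x
  proof -
    have "2 < norm x" "K \<le> inf_inner V x / sup_outer V x"
      using that r1[of x] by (auto simp: r_def)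
    from L_trunc_exp_norm_le[OF \<alpha> V \<phi> this(1) \<open>0 < K\<close> this(2)]
    have "L_trunc \<alpha> V \<phi> x \<le> 1/2 * (exp (V x) * inf_inner V x * \<phi> x * (- D))"
      by (simp add: D_def d_def c_def)
    then show ?thesis
      by (simp add: mult_ac)
  qed
  obtain B1 where B1: "\<And>x. norm x \<le> r \<Longrightarrow> L_trunc \<alpha> V \<phi> x \<le> B1"
    using L_trunc_bounded_above[OF \<alpha> V(2) \<phi>(1)] by metis
  obtain B2 where B2: "\<And>x. norm x \<le> r \<Longrightarrow> exp (V x) * inf_inner V x * \<phi> x \<le> B2"
    using weighted_inf_inner_bounded_above[OF V(2) \<phi>(1)] assms(7) by (metis less_imp_le less_trans zero_less_one)
  \<comment> \<open>The second entry covers the upper bound of the operator plus the term to be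
    absorbed; the entry 1 ensures \<open>0 < b\<close>.\<close>
  define b where "b = max 1 (B1 + D / 2 * B2)"
  have "L_trunc \<alpha> V \<phi> x \<le> - (D / 2) * (exp (V x) * inf_inner V x) * \<phi> x + b * indicator (ball 0 r) x" for x
  proof (cases "norm x < r")
    case True
    have "D / 2 * (exp (V x) * inf_inner V x * \<phi> x) \<le> D / 2 * B2"
      using B2[of x] True \<open>0 < D\<close> by (intro mult_left_mono) auto
    moreover have "L_trunc \<alpha> V \<phi> x \<le> B1"
      using B1[of x] True by simp
    ultimately show ?thesis
      using True by (simp add: b_def mult.assoc)
  next
    case False
    then show ?thesis using large[of x] by simp
  qed
  moreover have "0 < b" "0 < r"
    by (auto simp: b_def r_def)
  ultimately show ?thesis
    using \<open>0 < D\<close> by (intro exI[of _ "D / 2"] exI[of _ b] exI[of _ r]) auto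
qed

end
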